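(* Let $n \ge 1$ be an integer such that $2n+1$ is a prime, and let $\mathcal{F}$ be the family of all minimum dominating sets of the graph $C_{2n+1}^n$ (the Cartesian product of $n$ copies of the cycle of length $2n+1$). Then every $S \in \mathcal{F}$ has a defining set (with respect to $\mathcal{F}$) of size at most $n!\,2^n$.
   Context: A set $S$ of vertices of a graph is a dominating set if every vertex either lies in $S$ or is adjacent to a vertex of $S$; a minimum dominating set is a dominating set of smallest possible size. For a family $\mathcal{F}$ of sets and $S \in \mathcal{F}$, a set $D \subseteq S$ is a defining set for $(S,\mathcal{F})$ if $S$ is the only member of $\mathcal{F}$ containing $D$. *)

theory Defs
  imports "HOL-Library.FuncSet" "HOL-Computational_Algebra.Primes"
begin

record 'a graph =
  verts :: "'a set"
  adj :: "'a \<Rightarrow> 'a \<Rightarrow> bool"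

text \<open>Residues modulo \<open>m\<close> are represented by \<open>{..<m}\<close>; this is a simple graph for \<open>m \<ge> 3\<close>.\<close>

definition cycle_graph :: "nat \<Rightarrow> nat graph" where
  "cycle_graph m =
    \<lparr>verts = {..<m},
     adj = (\<lambda>u v. u < m \<and> v < m \<and> (v = (u + 1) mod m \<or> u = (v + 1) mod m))\<rparr>"

text \<open>
  Vertices are extensional functions on the index set \<open>I\<close>, so that two vertices are equal
  iff all their coordinates agree.
\<close>

definition cartesian_product :: "'i set \<Rightarrow> ('i \<Rightarrow> 'a graph) \<Rightarrow> ('i \<Rightarrow> 'a) graph" where
  "cartesian_product I G =
    \<lparr>verts = (\<Pi>\<^sub>E i\<in>I. verts (G i)),
     adj = (\<lambda>x y. x \<in> (\<Pi>\<^sub>E i\<in>I. verts (G i)) \<and> y \<in> (\<Pi>\<^sub>E i\<in>I. verts (G i)) \<and>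
       (\<exists>i\<in>I. adj (G i) (x i) (y i) \<and> (\<forall>j\<in>I - {i}. x j = y j)))\<rparr>"

definition cartesian_power :: "'a graph \<Rightarrow> nat \<Rightarrow> (nat \<Rightarrow> 'a) graph" where
  "cartesian_power G n = cartesian_product {..<n} (\<lambda>_. G)"

definition dominating_set :: "'a graph \<Rightarrow> 'a set \<Rightarrow> bool" where
  "dominating_set G S \<longleftrightarrow>
    S \<subseteq> verts G \<and> (\<forall>v\<in>verts G. v \<in> S \<or> (\<exists>u\<in>S. adj G v u))"

text \<open>Meaningful for finite graphs only, since \<open>card\<close> is \<open>0\<close> on infinite sets.\<close>

definition min_dominating_set :: "'a graph \<Rightarrow> 'a set \<Rightarrow> bool" where
  "min_dominating_set G S \<longleftrightarrow>
    dominating_set G S \<and> (\<forall>T. dominating_set G T \<longrightarrow> card S \<le> card T)"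

definition defining_set :: "'a set set \<Rightarrow> 'a set \<Rightarrow> 'a set \<Rightarrow> bool" where
  "defining_set F S D \<longleftrightarrow> S \<in> F \<and> D \<subseteq> S \<and> (\<forall>T\<in>F. D \<subseteq> T \<longrightarrow> T = S)"

end

theory Submission
  imports Defs "HOL-Library.Function_Algebras" "HOL-Library.Indicator_Function"
    "HOL-Computational_Algebra.Field_as_Ring" "HOL-Number_Theory.Cong"
    "Subresultants.Subresultant_Gcd"
begin

text \<open>
  Put \<open>p = 2n + 1\<close>. A ball of radius one in the graph has \<open>p\<close> elements, and a perfect code exists,
  so the minimum dominating sets are exactly the perfect codes. Hence the difference \<open>g\<close> of the
  indicator functions of two of them, \<open>S\<close> and \<open>T\<close>, sums to zero over every ball. On the Fourier
  side, the transform of \<open>g\<close> at \<open>a\<close> can only be nonzero if \<open>1 + \<Sum>\<^sub>i (\<zeta>\<^bsup>a i\<^esup> + \<zeta>\<^bsup>-a i\<^esup>) = 0\<close> for a primitive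
  \<open>p\<close>-th root of unity \<open>\<zeta>\<close>. Since \<open>1 + X + \<dots> + X\<^bsup>p-1\<^esup>\<close> is irreducible over the rationals, the
  exponents \<open>0, \<plusminus>a\<^sub>0, \<dots>, \<plusminus>a\<^sub>n\<^sub>-\<^sub>1\<close> then run through every residue exactly once, so that \<open>a\<close> is one
  of the \<open>n! 2\<^sup>n\<close> signed permutations of \<open>1, \<dots>, n\<close>. Hence \<open>g\<close> lies in a space of dimension at most
  \<open>n! 2\<^sup>n\<close>, and by linear algebra \<open>S\<close> has a subset \<open>D\<close>, independent of \<open>T\<close>, of at most that size
  such that \<open>g\<close> vanishes on \<open>S\<close> as soon as it vanishes on \<open>D\<close>, that is, as soon as \<open>D \<subseteq> T\<close>.
\<close>

section \<open>Vanishing sums of roots of unity of prime order\<close>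

lemma prime_elem_dvd_coeff_0_right_factor:
  fixes A B :: "'a::idom poly"
  assumes q: "prime_elem q" and coeffs: "\<And>i. i < degree (A * B) \<Longrightarrow> q dvd coeff (A * B) i"
    and lead: "\<not> q dvd lead_coeff (A * B)" and q_A: "q dvd coeff A 0" and B: "degree B > 0"
  shows "q dvd coeff B 0"
proof (rule ccontr)
  assume q_B: "\<not> q dvd coeff B 0"
  have lead_A: "\<not> q dvd lead_coeff A"
    using lead unfolding lead_coeff_mult by (blast intro: dvd_mult2)
  define k where "k = (LEAST k. \<not> q dvd coeff A k)"
  have not_dvd_k: "\<not> q dvd coeff A k" and "k \<le> degree A"
    unfolding k_def using lead_A by (rule LeastI, rule Least_le)
  have dvd_below_k: "q dvd coeff A i" if "i < k" for i
    using that not_less_Least unfolding k_def by blast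
  have "A \<noteq> 0" "B \<noteq> 0"
    using lead_A B by auto
  then have "k < degree (A * B)"
    using \<open>k \<le> degree A\<close> B by (subst degree_mult_eq) auto
  have "coeff (A * B) k = coeff A k * coeff B 0 + (\<Sum>i<k. coeff A i * coeff B (k - i))"
    by (simp add: coeff_mult lessThan_Suc_atMost[symmetric])
  moreover have "q dvd (\<Sum>i<k. coeff A i * coeff B (k - i))"
    using dvd_below_k by (intro dvd_sum) auto
  ultimately have "q dvd coeff A k * coeff B 0"
    using coeffs[OF \<open>k < degree (A * B)\<close>] by (simp add: dvd_add_left_iff)
  then show False
    using not_dvd_k q_B prime_elem_dvd_multD[OF q] by blast
qed

lemma eisenstein_criterion:
  fixes G H :: "'a::idom poly"
  assumes q: "prime_elem q" and coeffs: "\<And>i. i < degree (G * H) \<Longrightarrow> q dvd coeff (G * H) i"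
    and lead: "\<not> q dvd lead_coeff (G * H)" and square: "\<not> q\<^sup>2 dvd coeff (G * H) 0"
  shows "degree G = 0 \<or> degree H = 0"
proof (rule ccontr)
  assume "\<not> (degree G = 0 \<or> degree H = 0)"
  then have pos: "degree G > 0" "degree H > 0"
    by simp_all
  then have "G \<noteq> 0" "H \<noteq> 0"
    by auto
  then have "degree (G * H) > 0"
    using pos by (simp add: degree_mult_eq)
  then have "q dvd coeff G 0 * coeff H 0"
    using coeffs[of 0] by (simp add: coeff_mult)
  then consider (left) "q dvd coeff G 0" | (right) "q dvd coeff H 0"
    using prime_elem_dvd_multD[OF q] by blast
  then have "q dvd coeff G 0 \<and> q dvd coeff H 0"
  proof cases
    case left
    with prime_elem_dvd_coeff_0_right_factor[OF q coeffs lead] pos show ?thesis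
      by blast
  next
    case right
    with prime_elem_dvd_coeff_0_right_factor[of q H G] q coeffs lead pos show ?thesis
      by (simp add: mult.commute)
  qed
  then show False
    using square by (simp add: coeff_mult power2_eq_square mult_dvd_mono)
qed

definition geometric_poly :: "nat \<Rightarrow> 'a::comm_semiring_1 poly" where
  "geometric_poly m = (\<Sum>k<m. monom 1 k)"

lemma coeff_geometric_poly: "coeff (geometric_poly m) k = (if k < m then 1 else 0)"
  by (simp add: geometric_poly_def coeff_sum if_distrib sum.delta cong: if_cong)

lemma degree_geometric_poly: "degree (geometric_poly m :: 'a::comm_semiring_1 poly) = m - 1"
proof (rule antisym)
  show "degree (geometric_poly m :: 'a poly) \<le> m - 1"
    by (rule degree_le) (auto simp: coeff_geometric_poly)
  show "m - 1 \<le> degree (geometric_poly m :: 'a poly)"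
    by (cases "m = 0") (auto simp: coeff_geometric_poly intro: le_degree)
qed

lemma coeff_geometric_poly_pcompose_X_plus_1:
  "coeff (geometric_poly m \<circ>\<^sub>p [:1, 1:] :: 'a::comm_ring_1 poly) k = of_nat (m choose Suc k)"
proof -
  let ?Y = "[:1, 1 :: 'a:]"
  have "geometric_poly m \<circ>\<^sub>p ?Y = (\<Sum>k<m. ?Y ^ k)"
    by (simp add: geometric_poly_def pcompose_sum monom_altdef pcompose_hom.hom_power)
  moreover have "?Y - 1 = [:0, 1:]"
    by (simp only: one_pCons diff_pCons diff_self diff_0_right)
  ultimately have "?Y ^ m - 1 = pCons 0 (geometric_poly m \<circ>\<^sub>p ?Y)"
    unfolding power_diff_1_eq[of ?Y m] by simp
  then have "coeff (geometric_poly m \<circ>\<^sub>p ?Y) k = coeff (?Y ^ m - 1) (Suc k)"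
    by simp
  also have "\<dots> = coeff (?Y ^ m) (Suc k)"
    by simp
  also have "\<dots> = of_nat (m choose Suc k)"
  proof (cases "Suc k \<le> m")
    case True
    then show ?thesis
      unfolding coeff_linear_poly_power[OF True] by simp
  next
    case False
    then show ?thesis
      by (subst coeff_eq_0) (simp_all only: degree_linear_power not_le binomial_eq_0 of_nat_0)
  qed
  finally show ?thesis .
qed

lemma irreducible_geometric_poly:
  assumes p: "prime p"
  shows "irreducible (geometric_poly p :: int poly)"
proof (rule irreducibleI)
  have p_ge_2: "p \<ge> 2"
    using p by (rule prime_ge_2_nat)
  then show "geometric_poly p \<noteq> (0 :: int poly)" "\<not> geometric_poly p dvd (1 :: int poly)"
    using degree_geometric_poly[of p, where 'a = int] by (auto simp: poly_dvd_1)
  fix G H :: "int poly"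
  assume GH: "geometric_poly p = G * H"
  let ?P = "geometric_poly p \<circ>\<^sub>p [:1, 1:] :: int poly"
  have deg: "degree ?P = p - 1"
    by (simp add: degree_pcompose degree_geometric_poly)
  have P_eq: "?P = (G \<circ>\<^sub>p [:1, 1:]) * (H \<circ>\<^sub>p [:1, 1:])"
    by (simp add: GH pcompose_mult)
  have "degree (G \<circ>\<^sub>p [:1, 1:]) = 0 \<or> degree (H \<circ>\<^sub>p [:1, 1:]) = 0"
  proof (rule eisenstein_criterion[of "int p"], fold P_eq)
    show "int p dvd coeff ?P i" if "i < degree ?P" for i
      using that p unfolding deg coeff_geometric_poly_pcompose_X_plus_1 of_nat_dvd_iff
      by (intro dvd_choose_prime) auto
    show "\<not> int p dvd lead_coeff ?P"
      using p_ge_2 unfolding deg coeff_geometric_poly_pcompose_X_plus_1 of_nat_dvd_iff by simp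
    show "\<not> (int p)\<^sup>2 dvd coeff ?P 0"
      using p_ge_2 unfolding coeff_geometric_poly_pcompose_X_plus_1 by (simp add: power2_eq_square)
  qed (use p in simp)
  then have "degree G = 0 \<or> degree H = 0"
    by (simp add: degree_pcompose)
  moreover have "coeff G 0 * coeff H 0 = 1"
    using arg_cong[OF GH, of "\<lambda>P. coeff P 0"] p_ge_2
    by (simp add: coeff_geometric_poly coeff_mult)
  then have "coeff G 0 dvd 1" "coeff H 0 dvd 1"
    by (metis dvd_triv_left, metis dvd_triv_right)
  ultimately show "G dvd 1 \<or> H dvd 1"
    by (auto simp: poly_dvd_1)
qed

lemma irreducible_dvd_of_common_root:
  fixes P Q :: "int poly" and z :: "'a::{field_char_0,field_gcd}"
  assumes P: "irreducible P" and "poly (of_int_poly P) z = 0" "poly (of_int_poly Q) z = 0"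
  shows "P dvd Q"
proof -
  let ?G = "gcd (of_int_poly P) (of_int_poly Q) :: 'a poly"
  have "poly ?G z = 0"
    using assms(2,3) by (simp add: poly_eq_0_iff_dvd)
  moreover have "?G \<noteq> 0"
    using P by auto
  ultimately have "degree ?G \<noteq> 0"
    by (auto elim!: degree_eq_zeroE)
  then have "resultant P Q = 0"
    by (metis of_int_0_eq_iff of_int_hom.resultant_hom resultant_0_gcd)
  then have "\<not> is_unit (gcd P Q)"
    by (auto simp: resultant_0_gcd poly_dvd_1)
  then show ?thesis
    using irreducibleD'[OF P gcd_dvd1] by (meson dvd_trans gcd_dvd2)
qed

definition primitive_root_unity :: "nat \<Rightarrow> 'a::monoid_mult \<Rightarrow> bool" where
  "primitive_root_unity m z \<longleftrightarrow> m > 0 \<and> (\<forall>k. z ^ k = 1 \<longleftrightarrow> m dvd k)"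

lemma primitive_root_unity_pos: "primitive_root_unity m z \<Longrightarrow> m > 0"
  by (simp add: primitive_root_unity_def)

lemma primitive_root_unity_power_self: "primitive_root_unity m z \<Longrightarrow> z ^ m = 1"
  by (simp add: primitive_root_unity_def)

lemma primitive_root_unity_nonzero:
  fixes z :: "'a::semidom"
  assumes "primitive_root_unity m z"
  shows "z \<noteq> 0"
  using primitive_root_unity_power_self[OF assms] primitive_root_unity_pos[OF assms]
  by (auto simp: power_0_left)

lemma primitive_root_unity_power_eq_iff:
  fixes z :: "'a::idom"
  assumes "primitive_root_unity m z"
  shows "z ^ k = z ^ l \<longleftrightarrow> [k = l] (mod m)"
proof (induction k l rule: linorder_wlog)
  case (le k l)
  have "z ^ k = z ^ l \<longleftrightarrow> z ^ k * (z ^ (l - k) - 1) = 0"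
    using le by (auto simp: algebra_simps simp flip: power_add)
  also have "\<dots> \<longleftrightarrow> m dvd l - k"
    using assms primitive_root_unity_nonzero[OF assms] by (simp add: primitive_root_unity_def)
  also have "\<dots> \<longleftrightarrow> [k = l] (mod m)"
    using le by (simp add: cong_altdef_nat cong_sym_eq[of k])
  finally show ?case .
qed (simp add: cong_sym_eq eq_commute)

lemma primitive_root_unity_power_mod:
  fixes z :: "'a::idom"
  assumes "primitive_root_unity m z"
  shows "z ^ (k mod m) = z ^ k"
  by (simp add: primitive_root_unity_power_eq_iff[OF assms] cong_def)

lemma primitive_root_unity_cis:
  assumes "m > 0"
  shows "primitive_root_unity m (cis (2 * pi / m))"
proof -
  let ?z = "cis (2 * pi / m)"
  have power: "?z ^ k = cis (2 * pi * k / m)" for k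
    by (simp add: DeMoivre mult.commute)
  have self: "?z ^ m = 1"
    using assms by (simp add: power)
  have "?z ^ k = 1 \<longleftrightarrow> m dvd k" for k
  proof -
    have "?z ^ k = ?z ^ (m * (k div m) + k mod m)"
      by simp
    also have "\<dots> = ?z ^ (k mod m)"
      unfolding power_add power_mult self by simp
    also have "\<dots> = 1 \<longleftrightarrow> k mod m = 0"
      using bij_betw_imp_inj_on[OF bij_betw_roots_unity[OF assms], THEN inj_onD, of "k mod m" 0]
        assms
      by (auto simp: power)
    finally show ?thesis
      by (simp add: dvd_eq_mod_eq_0)
  qed
  with assms show ?thesis
    by (simp add: primitive_root_unity_def)
qed

lemma sum_powers_root_unity:
  fixes w :: "'a::field"
  assumes "w ^ m = 1"
  shows "(\<Sum>k<m. w ^ k) = (if w = 1 then of_nat m else 0)"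
  using assms by (simp add: geometric_sum)

lemma sum_powers_primitive_root_unity_quotient:
  fixes z :: "'a::field"
  assumes z: "primitive_root_unity m z" and "k < m" "l < m"
  shows "(\<Sum>j<m. (z ^ k * inverse z ^ l) ^ j) = (if k = l then of_nat m else 0)"
proof -
  let ?w = "z ^ k * inverse z ^ l"
  have "?w ^ m = (z ^ m) ^ k * inverse (z ^ m) ^ l"
    by (simp add: power_mult_distrib power_inverse mult.commute flip: power_mult)
  then have "?w ^ m = 1"
    by (simp add: primitive_root_unity_power_self[OF z])
  moreover have "?w = 1 \<longleftrightarrow> z ^ k = z ^ l"
    using primitive_root_unity_nonzero[OF z] by (auto simp: power_inverse field_simps)
  then have "?w = 1 \<longleftrightarrow> k = l"
    using assms by (simp add: primitive_root_unity_power_eq_iff[OF z] cong_def)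
  ultimately show ?thesis
    by (simp add: sum_powers_root_unity)
qed

lemma sum_prime_roots_unity_eq_0_imp_card_fibres_eq:
  fixes z :: "'a::{field_char_0,field_gcd}"
  assumes p: "prime p" and z: "primitive_root_unity p z"
    and I: "finite I" and sum: "(\<Sum>i\<in>I. z ^ e i) = 0"
  shows "\<exists>c. \<forall>j<p. card {i \<in> I. e i mod p = j} = c"
proof -
  define P :: "int poly" where "P = (\<Sum>i\<in>I. monom 1 (e i mod p))"
  have irreducible: "irreducible (geometric_poly p :: int poly)"
    using p by (rule irreducible_geometric_poly)
  have "poly (of_int_poly P) z = 0"
    using sum
    by (simp add: P_def hom_distribs poly_sum poly_monom primitive_root_unity_power_mod[OF z])
  moreover have "z \<noteq> 1"
    using z prime_gt_1_nat[OF p] by (auto simp: primitive_root_unity_def dest: spec[of _ 1])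
  then have "poly (of_int_poly (geometric_poly p)) z = 0"
    by (simp add: geometric_poly_def hom_distribs poly_sum poly_monom sum_powers_root_unity
        primitive_root_unity_power_self[OF z])
  ultimately obtain H where P_eq: "P = geometric_poly p * H"
    using irreducible_dvd_of_common_root[OF irreducible] by blast
  have "degree P < p"
    unfolding P_def using prime_gt_0_nat[OF p]
    by (intro degree_sum_less) (simp_all add: degree_monom_eq)
  then have "degree H = 0"
    using P_eq irreducible by (cases "H = 0") (auto simp: degree_mult_eq degree_geometric_poly)
  then obtain h where H_eq: "H = [:h:]"
    by (rule degree_eq_zeroE)
  have "int (card {i \<in> I. e i mod p = j}) = h" if "j < p" for j
  proof -
    have "int (card {i \<in> I. e i mod p = j}) = coeff P j"
      using I by (simp add: P_def coeff_sum flip: sum.inter_filter)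
    also have "\<dots> = h"
      using that by (simp add: P_eq H_eq coeff_geometric_poly)
    finally show ?thesis .
  qed
  then show ?thesis
    by (metis nat_int)
qed

lemma sum_prime_roots_unity_eq_0_imp_inj_on:
  fixes z :: "'a::{field_char_0,field_gcd}"
  assumes p: "prime p" and z: "primitive_root_unity p z"
    and I: "finite I" "card I = p" and sum: "(\<Sum>i\<in>I. z ^ e i) = 0"
  shows "inj_on (\<lambda>i. e i mod p) I"
proof -
  obtain c where card_fibre: "card {i \<in> I. e i mod p = j} = c" if "j < p" for j
    using sum_prime_roots_unity_eq_0_imp_card_fibres_eq[OF p z I(1) sum] by blast
  have p_pos: "p > 0"
    using p by (rule prime_gt_0_nat)
  have "(\<Sum>j<p. card {i \<in> I. e i mod p = j}) = p"
    using p_pos sum.group[OF I(1), of "{..<p}" "\<lambda>i. e i mod p" "\<lambda>_. 1 :: nat"]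
    by (simp add: I(2) image_subset_iff)
  then have "p * c = p"
    by (simp add: card_fibre)
  then have "c = 1"
    using p_pos by simp
  show ?thesis
  proof (rule inj_onI)
    fix i k assume "i \<in> I" "k \<in> I" "e i mod p = e k mod p"
    moreover have "card {l \<in> I. e l mod p = e k mod p} \<le> Suc 0"
      using card_fibre p_pos \<open>c = 1\<close> by simp
    ultimately show "i = k"
      using I(1) by (simp add: card_le_Suc0_iff_eq)
  qed
qed

section \<open>The graph as a discrete torus\<close>

definition torus :: "nat \<Rightarrow> nat \<Rightarrow> (nat \<Rightarrow> nat) set" where
  "torus m n = {..<n} \<rightarrow>\<^sub>E {..<m}"

definition shift :: "nat \<Rightarrow> nat \<Rightarrow> nat \<Rightarrow> (nat \<Rightarrow> nat) \<Rightarrow> nat \<Rightarrow> nat" where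
  "shift m i k x = x(i := (x i + k) mod m)"

text \<open>For \<open>m \<le> 2\<close> the two neighbours in a direction coincide and are counted twice.\<close>

definition ball_sum :: "nat \<Rightarrow> nat \<Rightarrow> ((nat \<Rightarrow> nat) \<Rightarrow> 'b::comm_monoid_add) \<Rightarrow> (nat \<Rightarrow> nat) \<Rightarrow> 'b" where
  "ball_sum m n f x = f x + (\<Sum>i<n. f (shift m i 1 x) + f (shift m i (m - 1) x))"

lemma finite_torus [simp]: "finite (torus m n)"
  by (simp add: torus_def finite_PiE)

lemma card_torus: "card (torus m n) = m ^ n"
  by (simp add: torus_def card_funcsetE)

lemma torus_less: "x \<in> torus m n \<Longrightarrow> i < n \<Longrightarrow> x i < m"
  by (auto simp: torus_def)

lemma torus_eqI:
  assumes "x \<in> torus m n" "y \<in> torus m n" "\<And>i. i < n \<Longrightarrow> x i = y i"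
  shows "x = y"
  using assms by (intro PiE_ext[of x "{..<n}" "\<lambda>_. {..<m}"]) (auto simp: torus_def)

lemma shift_in_torus:
  assumes "x \<in> torus m n" "i < n"
  shows "shift m i k x \<in> torus m n"
proof -
  have "m > 0"
    using torus_less[OF assms] by simp
  then show ?thesis
    using assms by (auto simp: torus_def shift_def PiE_iff extensional_def)
qed

lemma shift_shift_inverse:
  assumes "x \<in> torus m n" "i < n" "k + l = m"
  shows "shift m i l (shift m i k x) = x"
proof -
  have "((x i + k) mod m + l) mod m = (x i + (k + l)) mod m"
    by (simp add: mod_simps add.assoc)
  then show ?thesis
    using torus_less[OF assms(1,2)] assms(3) by (simp add: shift_def)
qed

lemma sum_torus_shift:
  fixes f :: "(nat \<Rightarrow> nat) \<Rightarrow> (nat \<Rightarrow> nat) \<Rightarrow> 'b::comm_monoid_add"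
  assumes "i < n" "k + l = m"
  shows "(\<Sum>x\<in>torus m n. f (shift m i k x) x) = (\<Sum>x\<in>torus m n. f x (shift m i l x))"
  using assms
  by (intro sum.reindex_bij_witness[where i = "shift m i l" and j = "shift m i k"])
     (auto simp: shift_in_torus shift_shift_inverse add.commute)

lemma ball_sum_self_adjoint:
  fixes f h :: "(nat \<Rightarrow> nat) \<Rightarrow> 'b::comm_semiring_0"
  assumes "m > 0"
  shows "(\<Sum>x\<in>torus m n. ball_sum m n f x * h x) = (\<Sum>x\<in>torus m n. f x * ball_sum m n h x)"
proof -
  let ?T = "torus m n"
  have shift_adjoint: "(\<Sum>x\<in>?T. f (shift m i k x) * h x) = (\<Sum>x\<in>?T. f x * h (shift m i l x))"
    if "i < n" "k + l = m" for i k l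
    using that by (rule sum_torus_shift)
  have "(\<Sum>x\<in>?T. ball_sum m n f x * h x) = (\<Sum>x\<in>?T. f x * h x) +
      (\<Sum>i<n. (\<Sum>x\<in>?T. f (shift m i 1 x) * h x) + (\<Sum>x\<in>?T. f (shift m i (m - 1) x) * h x))"
    unfolding ball_sum_def distrib_right sum.distrib sum_distrib_right
    by (simp add: sum.swap[of _ "{..<n}"])
  also have "\<dots> = (\<Sum>x\<in>?T. f x * h x) +
      (\<Sum>i<n. (\<Sum>x\<in>?T. f x * h (shift m i 1 x)) + (\<Sum>x\<in>?T. f x * h (shift m i (m - 1) x)))"
    using assms shift_adjoint[of _ 1 "m - 1"] shift_adjoint[of _ "m - 1" 1]
    by (simp add: add.commute)
  also have "\<dots> = (\<Sum>x\<in>?T. f x * ball_sum m n h x)"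
    unfolding ball_sum_def distrib_left sum.distrib sum_distrib_left
    by (simp add: sum.swap[of _ "{..<n}"])
  finally show ?thesis .
qed

lemma sum_ball_sum:
  fixes f :: "(nat \<Rightarrow> nat) \<Rightarrow> 'b::comm_semiring_1"
  assumes "m > 0"
  shows "(\<Sum>x\<in>torus m n. ball_sum m n f x) = of_nat (2 * n + 1) * (\<Sum>x\<in>torus m n. f x)"
proof -
  have "ball_sum m n (\<lambda>_. 1 :: 'b) x = of_nat (2 * n + 1)" for x
    by (simp add: ball_sum_def algebra_simps flip: mult_2)
  then show ?thesis
    using ball_sum_self_adjoint[OF assms, of n f "\<lambda>_. 1"]
    by (simp add: mult.commute flip: sum_distrib_right)
qed

lemma mod_add_1_eq_iff:
  fixes u v :: nat
  assumes "u < m" "v < m"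
  shows "u = (v + 1) mod m \<longleftrightarrow> v = (u + (m - 1)) mod m"
proof
  assume u_eq: "u = (v + 1) mod m"
  have "(u + (m - 1)) mod m = (v + 1 + (m - 1)) mod m"
    by (simp add: u_eq mod_simps)
  then show "v = (u + (m - 1)) mod m"
    using assms by simp
next
  assume v_eq: "v = (u + (m - 1)) mod m"
  have "(v + 1) mod m = (u + (m - 1) + 1) mod m"
    unfolding v_eq by (rule mod_add_left_eq)
  then show "u = (v + 1) mod m"
    using assms by simp
qed

lemma verts_cartesian_power_cycle: "verts (cartesian_power (cycle_graph m) n) = torus m n"
  by (simp add: cartesian_power_def cartesian_product_def cycle_graph_def torus_def)

lemma eq_shift_iff:
  assumes "x \<in> torus m n" "y \<in> torus m n" "i < n"
  shows "y = shift m i k x \<longleftrightarrow> y i = (x i + k) mod m \<and> (\<forall>j\<in>{..<n} - {i}. x j = y j)"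
proof
  assume "y i = (x i + k) mod m \<and> (\<forall>j\<in>{..<n} - {i}. x j = y j)"
  with assms show "y = shift m i k x"
    by (intro torus_eqI[OF assms(2) shift_in_torus]) (auto simp: shift_def)
qed (auto simp: shift_def)

lemma adj_cartesian_power_cycle:
  assumes x: "x \<in> torus m n"
  shows "adj (cartesian_power (cycle_graph m) n) x y \<longleftrightarrow>
    (\<exists>i<n. y = shift m i 1 x \<or> y = shift m i (m - 1) x)"
proof -
  have "adj (cartesian_power (cycle_graph m) n) x y \<longleftrightarrow> y \<in> torus m n \<and>
    (\<exists>i<n. (y i = (x i + 1) mod m \<or> x i = (y i + 1) mod m) \<and> (\<forall>j\<in>{..<n} - {i}. x j = y j))"
    using x torus_less[of x m n] torus_less[of y m n]
    by (auto simp: cartesian_power_def cartesian_product_def cycle_graph_def simp flip: torus_def)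
  also have "\<dots> \<longleftrightarrow> y \<in> torus m n \<and> (\<exists>i<n. y = shift m i 1 x \<or> y = shift m i (m - 1) x)"
    using eq_shift_iff[OF x] mod_add_1_eq_iff[OF torus_less[OF x] torus_less] by blast
  finally show ?thesis
    using shift_in_torus[OF x] by blast
qed

lemma dominating_set_iff_ball_sum:
  "dominating_set (cartesian_power (cycle_graph m) n) S \<longleftrightarrow>
    S \<subseteq> torus m n \<and> (\<forall>x\<in>torus m n. ball_sum m n (indicator S) x \<ge> (1 :: nat))"
proof -
  have "x \<in> S \<or> (\<exists>u\<in>S. adj (cartesian_power (cycle_graph m) n) x u) \<longleftrightarrow>
    ball_sum m n (indicator S) x \<ge> (1 :: nat)" if "x \<in> torus m n" for x
  proof -
    have "ball_sum m n (indicator S) x = (0 :: nat) \<longleftrightarrow>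
      x \<notin> S \<and> (\<forall>i<n. shift m i 1 x \<notin> S \<and> shift m i (m - 1) x \<notin> S)"
      by (auto simp: ball_sum_def indicator_eq_0_iff)
    then show ?thesis
      unfolding adj_cartesian_power_cycle[OF that] by (auto simp: Suc_le_eq)
  qed
  then show ?thesis
    by (auto simp: dominating_set_def verts_cartesian_power_cycle)
qed

section \<open>Minimum dominating sets are perfect codes\<close>

definition perfect_code :: "nat \<Rightarrow> nat \<Rightarrow> (nat \<Rightarrow> nat) set \<Rightarrow> bool" where
  "perfect_code m n S \<longleftrightarrow>
    S \<subseteq> torus m n \<and> (\<forall>x\<in>torus m n. ball_sum m n (indicator S) x = (1 :: nat))"

lemma sum_ball_sum_indicator:
  assumes "m > 0" "S \<subseteq> torus m n"
  shows "(\<Sum>x\<in>torus m n. ball_sum m n (indicator S) x) = (2 * n + 1) * card S"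
proof -
  have "(\<Sum>x\<in>torus m n. indicator S x :: nat) = card S"
    using assms(2) by (simp add: sum_indicator_eq_card Int_absorb1)
  with sum_ball_sum[OF assms(1), of n "indicator S :: _ \<Rightarrow> nat"] show ?thesis
    by simp
qed

lemma card_perfect_code:
  assumes "m > 0" "perfect_code m n S"
  shows "(2 * n + 1) * card S = m ^ n"
  using assms sum_ball_sum_indicator[of m S n] by (simp add: perfect_code_def card_torus)

lemma perfect_code_imp_dominating_set:
  "perfect_code m n S \<Longrightarrow> dominating_set (cartesian_power (cycle_graph m) n) S"
  by (simp add: perfect_code_def dominating_set_iff_ball_sum)

lemma small_dominating_set_imp_perfect_code:
  assumes m: "m > 0" and dom: "dominating_set (cartesian_power (cycle_graph m) n) S"
    and small: "(2 * n + 1) * card S \<le> m ^ n"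
  shows "perfect_code m n S"
proof -
  let ?b = "ball_sum m n (indicator S) :: _ \<Rightarrow> nat"
  have S: "S \<subseteq> torus m n" and ge: "\<And>x. x \<in> torus m n \<Longrightarrow> 1 \<le> ?b x"
    using dom by (auto simp: dominating_set_iff_ball_sum)
  have "(\<Sum>x\<in>torus m n. ?b x) \<le> (\<Sum>x\<in>torus m n. 1)"
    using small by (simp add: sum_ball_sum_indicator[OF m S] card_torus)
  then have sum_eq: "(\<Sum>x\<in>torus m n. 1) = (\<Sum>x\<in>torus m n. ?b x)"
    by (intro antisym sum_mono[OF ge])
  have "?b x = 1" if "x \<in> torus m n" for x
    using sum_mono_inv[OF sum_eq ge that finite_torus] by simp
  with S show ?thesis
    by (simp add: perfect_code_def)
qed

lemma sum_lessThan_symmetric: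
  fixes f :: "nat \<Rightarrow> 'b::comm_monoid_add"
  shows "(\<Sum>k<2 * n + 1. f k) = f 0 + (\<Sum>i<n. f (i + 1) + f (2 * n - i))"
proof -
  have "(\<Sum>k<2 * n + 1. f k) = f 0 + (\<Sum>i<n + n. f (Suc i))"
    by (simp add: sum.lessThan_Suc_shift mult_2 del: sum.lessThan_Suc)
  also have "(\<Sum>i<n + l. f (Suc i)) = (\<Sum>i<n. f (Suc i)) + (\<Sum>i<l. f (Suc (n + i)))" for l
    by (induction l) (simp_all add: ac_simps)
  also have "(\<Sum>i<n. f (Suc (n + i))) = (\<Sum>i<n. f (Suc (n + (n - Suc i))))"
    by (rule sum.nat_diff_reindex[symmetric])
  also have "\<dots> = (\<Sum>i<n. f (2 * n - i))"
    by (intro sum.cong refl arg_cong[of _ _ f]) auto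
  finally show ?thesis
    by (simp add: sum.distrib)
qed

definition checksum :: "nat \<Rightarrow> (nat \<Rightarrow> nat) \<Rightarrow> nat" where
  "checksum n x = (\<Sum>i<n. (i + 1) * x i)"

text \<open>The perfect Lee code of Golomb and Welch: the possible changes of the check sum caused by
  one step are \<open>\<plusminus>1, \<dots>, \<plusminus>n\<close>, that is, all nonzero residues modulo \<open>2n + 1\<close>.\<close>

definition lee_code :: "nat \<Rightarrow> (nat \<Rightarrow> nat) set" where
  "lee_code n = {x \<in> torus (2 * n + 1) n. 2 * n + 1 dvd checksum n x}"

lemma cong_checksum_shift:
  assumes "i < n"
  shows "[checksum n (shift m i k x) = checksum n x + (i + 1) * k] (mod m)"
proof -
  define r where "r = (\<Sum>j\<in>{..<n} - {i}. (j + 1) * x j)"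
  have "checksum n (shift m i k x) = (i + 1) * ((x i + k) mod m) + r"
    unfolding r_def checksum_def using assms
    by (subst sum.remove[of _ i]) (auto simp: shift_def intro!: sum.cong)
  also have "[\<dots> = (i + 1) * (x i + k) + r] (mod m)"
    by (intro cong_add cong_scalar_left cong_refl) (simp add: cong_def)
  also have "(i + 1) * (x i + k) + r = checksum n x + (i + 1) * k"
    unfolding r_def checksum_def using assms
    by (subst (2) sum.remove[of _ i]) (auto simp: algebra_simps)
  finally show ?thesis .
qed

lemma sum_of_bool_dvd_add:
  fixes m s :: nat
  assumes "m > 0"
  shows "(\<Sum>k<m. of_bool (m dvd s + k) :: 'b::semiring_1) = 1"
proof -
  let ?r = "\<lambda>k. (s + k) mod m"
  have inj: "inj_on ?r {..<m}"
  proof (rule inj_onI)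
    fix k l assume "k \<in> {..<m}" "l \<in> {..<m}" "?r k = ?r l"
    then show "k = l"
      by (simp add: cong_add_lcancel_nat cong_less_modulus_unique_nat flip: cong_def)
  qed
  have surj: "?r ` {..<m} = {..<m}"
    using assms by (intro endo_inj_surj[OF _ _ inj]) auto
  have "(\<Sum>k<m. of_bool (m dvd s + k) :: 'b) = (\<Sum>k\<in>?r ` {..<m}. of_bool (k = 0))"
    by (subst sum.reindex[OF inj]) (simp add: dvd_eq_mod_eq_0)
  also have "\<dots> = 1"
    using assms unfolding surj by simp
  finally show ?thesis .
qed

lemma perfect_code_lee_code: "perfect_code (2 * n + 1) n (lee_code n)"
proof -
  define p where "p = 2 * n + 1"
  have indicator_lee_code: "indicator (lee_code n) y = (of_bool (p dvd checksum n y) :: nat)"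
    if "y \<in> torus p n" for y
    using that by (simp add: lee_code_def indicator_def p_def)
  have "ball_sum p n (indicator (lee_code n)) x = (1 :: nat)" if x: "x \<in> torus p n" for x
  proof -
    let ?s = "checksum n x"
    have shift: "indicator (lee_code n) (shift p i k x) = (of_bool (p dvd ?s + (i + 1) * k) :: nat)"
      if "i < n" for i k
      unfolding indicator_lee_code[OF shift_in_torus[OF x that]]
        cong_dvd_iff[OF cong_checksum_shift[OF that]] ..
    have forward: "indicator (lee_code n) (shift p i 1 x) = (of_bool (p dvd ?s + (i + 1)) :: nat)"
      if "i < n" for i
      unfolding shift[OF that] by simp
    have backward:
      "indicator (lee_code n) (shift p i (p - 1) x) = (of_bool (p dvd ?s + (2 * n - i)) :: nat)"
      if "i < n" for i
    proof -
      have "?s + (i + 1) * (p - 1) = ?s + (2 * n - i) + p * i"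
        using that by (simp add: p_def algebra_simps)
      then show ?thesis
        by (simp only: shift[OF that] dvd_add_left_iff dvd_triv_left)
    qed
    have "ball_sum p n (indicator (lee_code n)) x = of_bool (p dvd ?s) +
        (\<Sum>i<n. of_bool (p dvd ?s + (i + 1)) + of_bool (p dvd ?s + (2 * n - i)) :: nat)"
      using forward backward by (simp add: ball_sum_def indicator_lee_code[OF x])
    also have "\<dots> = (\<Sum>k<p. of_bool (p dvd ?s + k))"
      unfolding p_def by (subst sum_lessThan_symmetric) simp
    also have "\<dots> = 1"
      by (rule sum_of_bool_dvd_add) (simp add: p_def)
    finally show ?thesis .
  qed
  then show ?thesis
    by (auto simp: perfect_code_def lee_code_def p_def)
qed

lemma min_dominating_set_imp_perfect_code:
  assumes "min_dominating_set (cartesian_power (cycle_graph (2 * n + 1)) n) S"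
  shows "perfect_code (2 * n + 1) n S"
proof (rule small_dominating_set_imp_perfect_code)
  show "dominating_set (cartesian_power (cycle_graph (2 * n + 1)) n) S"
    using assms by (simp add: min_dominating_set_def)
  have "card S \<le> card (lee_code n)"
    using assms perfect_code_imp_dominating_set[OF perfect_code_lee_code]
    by (simp add: min_dominating_set_def)
  then have "(2 * n + 1) * card S \<le> (2 * n + 1) * card (lee_code n)"
    by (rule mult_le_mono2)
  also have "\<dots> = (2 * n + 1) ^ n"
    by (rule card_perfect_code[OF _ perfect_code_lee_code]) simp
  finally show "(2 * n + 1) * card S \<le> (2 * n + 1) ^ n" .
qed simp

section \<open>Fourier analysis on the torus\<close>

definition character :: "'a::field \<Rightarrow> nat \<Rightarrow> (nat \<Rightarrow> nat) \<Rightarrow> (nat \<Rightarrow> nat) \<Rightarrow> 'a" where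
  "character z n a x = (\<Prod>i<n. z ^ (a i * x i))"

definition fourier :: "'a::field \<Rightarrow> nat \<Rightarrow> nat \<Rightarrow> ((nat \<Rightarrow> nat) \<Rightarrow> 'a) \<Rightarrow> (nat \<Rightarrow> nat) \<Rightarrow> 'a" where
  "fourier z m n g a = (\<Sum>x\<in>torus m n. g x * character z n a x)"

definition ball_eigenvalue :: "'a::field \<Rightarrow> nat \<Rightarrow> (nat \<Rightarrow> nat) \<Rightarrow> 'a" where
  "ball_eigenvalue z n a = 1 + (\<Sum>i<n. z ^ a i + inverse z ^ a i)"

lemma character_shift:
  assumes z: "primitive_root_unity m z" and i: "i < n"
  shows "character z n a (shift m i k x) = character z n a x * z ^ (a i * k)"
proof -
  define r where "r = (\<Prod>j\<in>{..<n} - {i}. z ^ (a j * x j))"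
  have "character z n a (shift m i k x) = z ^ (a i * ((x i + k) mod m)) * r"
    unfolding character_def r_def using i
    by (subst prod.remove[of _ i]) (auto simp: shift_def intro!: prod.cong)
  also have "z ^ (a i * ((x i + k) mod m)) = z ^ (a i * (x i + k))"
    by (simp add: primitive_root_unity_power_eq_iff[OF z] cong_def mod_simps)
  also have "\<dots> * r = z ^ (a i * x i) * r * z ^ (a i * k)"
    by (simp add: power_add algebra_simps)
  also have "z ^ (a i * x i) * r = character z n a x"
    unfolding character_def r_def using i by (subst (2) prod.remove[of _ i]) auto
  finally show ?thesis .
qed

lemma ball_sum_character:
  assumes z: "primitive_root_unity m z"
  shows "ball_sum m n (character z n a) x = character z n a x * ball_eigenvalue z n a"
proof -
  have "z * z ^ (m - 1) = 1"
    using primitive_root_unity_power_self[OF z] primitive_root_unity_pos[OF z]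
    by (simp flip: power_Suc)
  then have "z ^ (m - 1) = inverse z"
    by (simp add: inverse_unique)
  then have "z ^ (a i * (m - 1)) = inverse z ^ a i" for i
    by (metis mult.commute power_mult)
  then show ?thesis
    by (simp add: ball_sum_def ball_eigenvalue_def character_shift[OF z] distrib_left
        sum_distrib_left)
qed

lemma fourier_ball_sum:
  assumes "primitive_root_unity m z"
  shows "fourier z m n (ball_sum m n g) a = fourier z m n g a * ball_eigenvalue z n a"
  unfolding fourier_def
  using ball_sum_self_adjoint[OF primitive_root_unity_pos[OF assms], of n g "character z n a"]
  by (simp add: ball_sum_character[OF assms] sum_distrib_right mult.assoc)

lemma character_orthogonality:
  fixes z :: "'a::field"
  assumes z: "primitive_root_unity m z" and x: "x \<in> torus m n" and y: "y \<in> torus m n"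
  shows "(\<Sum>a\<in>torus m n. character z n a x * character (inverse z) n a y) =
    (if x = y then of_nat m ^ n else 0)"
proof -
  have "(\<Sum>a\<in>torus m n. character z n a x * character (inverse z) n a y) =
      (\<Sum>a\<in>torus m n. \<Prod>i<n. (z ^ x i * inverse z ^ y i) ^ a i)"
    by (simp add: character_def power_mult_distrib mult.commute flip: prod.distrib power_mult)
  also have "\<dots> = (\<Prod>i<n. \<Sum>k<m. (z ^ x i * inverse z ^ y i) ^ k)"
    unfolding torus_def by (rule prod_sum_PiE[symmetric]) auto
  also have "\<dots> = (\<Prod>i<n. if x i = y i then of_nat m else 0)"
    using x y by (intro prod.cong refl)
      (simp add: sum_powers_primitive_root_unity_quotient[OF z] torus_less)
  also have "\<dots> = (if x = y then of_nat m ^ n else 0)"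
  proof (cases "x = y")
    case False
    then obtain i where "i < n" "x i \<noteq> y i"
      using torus_eqI[OF x y] by blast
    then have "(\<Prod>i<n. if x i = y i then of_nat m else 0 :: 'a) = 0"
      by (intro prod_zero) auto
    with False show ?thesis
      by simp
  qed simp
  finally show ?thesis .
qed

lemma fourier_inversion:
  assumes "primitive_root_unity m z" "y \<in> torus m n"
  shows "of_nat m ^ n * g y = (\<Sum>a\<in>torus m n. fourier z m n g a * character (inverse z) n a y)"
proof -
  have "(\<Sum>a\<in>torus m n. fourier z m n g a * character (inverse z) n a y) =
      (\<Sum>x\<in>torus m n. g x * (\<Sum>a\<in>torus m n. character z n a x * character (inverse z) n a y))"
    unfolding fourier_def sum_distrib_right sum_distrib_left
    by (subst sum.swap) (simp add: mult.assoc)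
  also have "\<dots> = (\<Sum>x\<in>torus m n. if x = y then of_nat m ^ n * g y else 0)"
    using assms by (intro sum.cong refl) (auto simp: character_orthogonality)
  also have "\<dots> = of_nat m ^ n * g y"
    using assms by simp
  finally show ?thesis ..
qed

definition ball_sum_kernel :: "nat \<Rightarrow> nat \<Rightarrow> ((nat \<Rightarrow> nat) \<Rightarrow> 'b::comm_monoid_add) set" where
  "ball_sum_kernel m n = {g. \<forall>x\<in>torus m n. ball_sum m n g x = 0}"

lemma fourier_expansion_of_ball_sum_kernel:
  assumes z: "primitive_root_unity m z" and y: "y \<in> torus m n" and g: "g \<in> ball_sum_kernel m n"
  shows "of_nat m ^ n * g y = (\<Sum>a | a \<in> torus m n \<and> ball_eigenvalue z n a = 0.
    fourier z m n g a * character (inverse z) n a y)"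
proof -
  have "fourier z m n g a * ball_eigenvalue z n a = 0" for a
    using g unfolding fourier_ball_sum[OF z, symmetric]
    by (simp add: fourier_def ball_sum_kernel_def)
  then show ?thesis
    unfolding fourier_inversion[OF z y] by (intro sum.mono_neutral_right) auto
qed

section \<open>Zeros of the ball eigenvalue\<close>

definition residue_abs :: "nat \<Rightarrow> nat \<Rightarrow> nat" where
  "residue_abs m k = min k (m - k)"

lemma residue_abs_eq_iff:
  assumes "k \<le> m" "l \<le> m"
  shows "residue_abs m k = residue_abs m l \<longleftrightarrow> k = l \<or> k = m - l"
  using assms by (auto simp: residue_abs_def min_def)

definition signed_permutations :: "nat \<Rightarrow> (nat \<Rightarrow> nat) set" where
  "signed_permutations n =
    {a \<in> torus (2 * n + 1) n. bij_betw (\<lambda>i. residue_abs (2 * n + 1) (a i)) {..<n} {1..n}}"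

lemma card_signed_permutations_le: "card (signed_permutations n) \<le> fact n * 2 ^ n"
proof -
  let ?p = "2 * n + 1"
  let ?encode = "\<lambda>a. (\<lambda>i\<in>{..<n}. residue_abs ?p (a i), {i \<in> {..<n}. a i \<le> n})"
  have "inj_on ?encode (signed_permutations n)"
  proof (rule inj_onI)
    fix a b assume ab: "a \<in> signed_permutations n" "b \<in> signed_permutations n"
      and encode_eq: "?encode a = ?encode b"
    have torus: "a \<in> torus ?p n" "b \<in> torus ?p n"
      using ab by (simp_all add: signed_permutations_def)
    then show "a = b"
    proof (rule torus_eqI)
      fix i assume i: "i < n"
      have "residue_abs ?p (a i) = residue_abs ?p (b i)"
        using fun_cong[OF arg_cong[OF encode_eq, of fst], of i] i by simp
      moreover have "a i \<le> n \<longleftrightarrow> b i \<le> n"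
        using arg_cong[OF encode_eq, of snd] i by auto
      moreover have "a i < ?p" "b i < ?p"
        using torus i by (simp_all only: torus_less)
      ultimately show "a i = b i"
        by (auto simp: residue_abs_eq_iff)
    qed
  qed
  moreover have "?encode ` signed_permutations n \<subseteq>
      {f \<in> {..<n} \<rightarrow>\<^sub>E {1..n}. inj_on f {..<n}} \<times> Pow {..<n}"
    unfolding signed_permutations_def bij_betw_def
    by (intro image_subsetI)
      (auto simp: restrict_PiE_iff inj_on_restrict_eq simp del: restrict_apply)
  ultimately have "card (signed_permutations n) \<le>
      card ({f \<in> {..<n} \<rightarrow>\<^sub>E {1..n}. inj_on f {..<n}} \<times> Pow {..<n})"
    by (rule card_inj_on_le) (auto simp: finite_PiE)
  also have "\<dots> = fact n * 2 ^ n"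
    by (simp add: card_cartesian_product card_inj_on_subset_funcset card_Pow fact_prod_rev)
  finally show ?thesis .
qed

text \<open>The residues \<open>0, a\<^sub>0, \<dots>, a\<^sub>n\<^sub>-\<^sub>1, -a\<^sub>n\<^sub>-\<^sub>1, \<dots>, -a\<^sub>0\<close>, in this order.\<close>

definition signed_residues :: "nat \<Rightarrow> (nat \<Rightarrow> nat) \<Rightarrow> nat \<Rightarrow> nat" where
  "signed_residues n a k =
    (if k = 0 then 0 else if k \<le> n then a (k - 1) else 2 * n + 1 - a (2 * n - k))"

lemma signed_residues_simps:
  "signed_residues n a 0 = 0"
  "i < n \<Longrightarrow> signed_residues n a (i + 1) = a i"
  "i < n \<Longrightarrow> signed_residues n a (2 * n - i) = 2 * n + 1 - a i"
  by (auto simp: signed_residues_def)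

lemma sum_power_signed_residues:
  assumes z: "primitive_root_unity (2 * n + 1) z" and a: "a \<in> torus (2 * n + 1) n"
  shows "(\<Sum>k<2 * n + 1. z ^ signed_residues n a k) = ball_eigenvalue z n a"
proof -
  have inverse: "z ^ (2 * n + 1 - a i) = inverse z ^ a i" if "i < n" for i
  proof -
    have "z ^ a i * z ^ (2 * n + 1 - a i) = z ^ (2 * n + 1)"
      using torus_less[OF a that] by (simp flip: power_add)
    then show ?thesis
      by (simp only: primitive_root_unity_power_self[OF z] power_inverse inverse_unique)
  qed
  show ?thesis
    unfolding sum_lessThan_symmetric ball_eigenvalue_def
    by (intro arg_cong2[of _ _ _ _ "(+)"] sum.cong refl)
      (simp_all only: signed_residues_simps inverse lessThan_iff power_0)
qed

lemma inj_on_signed_residues_imp_signed_permutation: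
  assumes a: "a \<in> torus (2 * n + 1) n"
    and inj: "inj_on (\<lambda>k. signed_residues n a k mod (2 * n + 1)) {..<2 * n + 1}"
  shows "a \<in> signed_permutations n"
proof -
  define p where "p = 2 * n + 1"
  note residues = signed_residues_simps[where a = a and n = n, folded p_def]
  have less: "a i < p" if "i < n" for i
    using torus_less[OF a that] by (simp add: p_def)
  have distinct: "signed_residues n a k mod p \<noteq> signed_residues n a l mod p"
    if "k < p" "l < p" "k \<noteq> l" for k l
    using inj that by (auto simp: p_def dest: inj_onD)
  have nonzero: "a i \<noteq> 0" if "i < n" for i
    using distinct[of 0 "i + 1"] that residues(1) residues(2)[OF that]
    by (intro notI) (auto simp: p_def)
  have neq: "a i \<noteq> a j" if "i < n" "j < n" "i \<noteq> j" for i j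
    using distinct[of "i + 1" "j + 1"] that residues(2) by (auto simp: p_def)
  have neq_neg: "a i \<noteq> p - a j" if "i < n" "j < n" for i j
  proof -
    have "i + 1 < p" "2 * n - j < p" "i + 1 \<noteq> 2 * n - j"
      using that by (auto simp: p_def)
    then show ?thesis
      using distinct[of "i + 1" "2 * n - j"] residues(2)[OF that(1)] residues(3)[OF that(2)] by auto
  qed
  have "inj_on (\<lambda>i. residue_abs p (a i)) {..<n}"
  proof (rule inj_onI, rule ccontr)
    fix i j assume ij: "i \<in> {..<n}" "j \<in> {..<n}" "i \<noteq> j"
      and abs_eq: "residue_abs p (a i) = residue_abs p (a j)"
    then show False
      using neq neq_neg less ij by (auto simp: residue_abs_eq_iff less_imp_le)
  qed
  moreover have "(\<lambda>i. residue_abs p (a i)) ` {..<n} \<subseteq> {1..n}"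
    using less nonzero by (fastforce simp: residue_abs_def p_def)
  ultimately have "bij_betw (\<lambda>i. residue_abs p (a i)) {..<n} {1..n}"
    by (simp add: bij_betw_def card_seteq card_image)
  with a show ?thesis
    by (simp add: signed_permutations_def p_def)
qed

lemma ball_eigenvalue_eq_0_imp_signed_permutation:
  fixes z :: "'a::{field_char_0,field_gcd}"
  assumes p: "prime (2 * n + 1)" and z: "primitive_root_unity (2 * n + 1) z"
    and a: "a \<in> torus (2 * n + 1) n" and eigenvalue: "ball_eigenvalue z n a = 0"
  shows "a \<in> signed_permutations n"
proof (rule inj_on_signed_residues_imp_signed_permutation[OF a])
  have "(\<Sum>k<2 * n + 1. z ^ signed_residues n a k) = 0"
    using sum_power_signed_residues[OF z a] eigenvalue by (rule trans)
  then show "inj_on (\<lambda>k. signed_residues n a k mod (2 * n + 1)) {..<2 * n + 1}"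
    by (intro sum_prime_roots_unity_eq_0_imp_inj_on[OF p z]) simp_all
qed

lemma card_zeros_ball_eigenvalue_le:
  fixes z :: "'a::{field_char_0,field_gcd}"
  assumes "prime (2 * n + 1)" "primitive_root_unity (2 * n + 1) z"
  shows "card {a \<in> torus (2 * n + 1) n. ball_eigenvalue z n a = 0} \<le> fact n * 2 ^ n"
proof -
  have "{a \<in> torus (2 * n + 1) n. ball_eigenvalue z n a = 0} \<subseteq> signed_permutations n"
    using ball_eigenvalue_eq_0_imp_signed_permutation[OF assms] by blast
  moreover have "finite (signed_permutations n)"
    by (simp add: signed_permutations_def)
  ultimately have "card {a \<in> torus (2 * n + 1) n. ball_eigenvalue z n a = 0} \<le>
      card (signed_permutations n)"
    by (intro card_mono)
  also have "\<dots> \<le> fact n * 2 ^ n"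
    by (rule card_signed_permutations_le)
  finally show ?thesis .
qed

section \<open>Defining sets\<close>

definition determining_set :: "('s \<Rightarrow> 'k::zero) set \<Rightarrow> 's set \<Rightarrow> 's set \<Rightarrow> bool" where
  "determining_set V S D \<longleftrightarrow> D \<subseteq> S \<and> (\<forall>g\<in>V. (\<forall>x\<in>D. g x = 0) \<longrightarrow> (\<forall>x\<in>S. g x = 0))"

lemma determining_set_subset: "determining_set V S D \<Longrightarrow> D \<subseteq> S"
  by (simp add: determining_set_def)

lemma determining_setD:
  assumes "determining_set V S D" "g \<in> V" "\<And>y. y \<in> D \<Longrightarrow> g y = 0" "x \<in> S"
  shows "g x = 0"
  using assms by (simp add: determining_set_def)

interpretation fun_space: vector_space "\<lambda>(r :: 'k::field) f (a :: 'a). r * f a"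
  by standard (auto simp: fun_eq_iff algebra_simps)

lemma sum_fun_apply: "(\<Sum>i\<in>I. f i) x = (\<Sum>i\<in>I. f i x)"
  by (induction I rule: infinite_finite_induct) simp_all

lemma in_span_unit_functions:
  fixes f :: "'a \<Rightarrow> 'k::field"
  assumes "finite A" and support: "\<And>a. a \<notin> A \<Longrightarrow> f a = 0"
  shows "f \<in> fun_space.span ((\<lambda>b a. of_bool (a = b)) ` A)"
proof -
  have "f = (\<Sum>b\<in>A. (\<lambda>a. f b * of_bool (a = b)))"
    using assms by (auto simp: fun_eq_iff sum_fun_apply of_bool_def if_distrib cong: if_cong)
  also have "\<dots> \<in> fun_space.span ((\<lambda>b a. of_bool (a = b)) ` A)"
    by (intro fun_space.span_sum fun_space.span_scale fun_space.span_base imageI)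
  finally show ?thesis .
qed

lemma sum_mult_eq_0_on_span:
  fixes c :: "'a \<Rightarrow> 'k::field"
  assumes "g \<in> fun_space.span B" and B: "\<And>f. f \<in> B \<Longrightarrow> (\<Sum>a\<in>A. c a * f a) = 0"
  shows "(\<Sum>a\<in>A. c a * g a) = 0"
  using assms(1)
proof (induction rule: fun_space.span_induct_alt)
  case (step r f g)
  have "(\<Sum>a\<in>A. c a * (r * f a + g a)) = r * (\<Sum>a\<in>A. c a * f a) + (\<Sum>a\<in>A. c a * g a)"
    by (simp add: sum_distrib_left sum.distrib algebra_simps)
  then show ?case
    using B[OF step.hyps(1)] step.IH by simp
qed simp

lemma exists_determining_set_card_le:
  fixes v :: "'s \<Rightarrow> 'a \<Rightarrow> 'k::field"
  assumes A: "finite A"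
  obtains D where "determining_set (range (\<lambda>c s. \<Sum>a\<in>A. c a * v s a)) S D"
    "finite D" "card D \<le> card A"
proof -
  define row where "row s a = (if a \<in> A then v s a else 0)" for s a
  let ?units = "(\<lambda>b a. of_bool (a = b)) ` A :: ('a \<Rightarrow> 'k) set"
  obtain B where B: "B \<subseteq> row ` S" "fun_space.independent B" "row ` S \<subseteq> fun_space.span B"
    by (rule fun_space.maximal_independent_subset)
  obtain D where D: "D \<subseteq> S" "inj_on row D" "B = row ` D"
    using B(1) by (auto simp: subset_image_inj)
  have "row s \<in> fun_space.span ?units" for s
    by (rule in_span_unit_functions[OF A]) (simp add: row_def)
  then have "B \<subseteq> fun_space.span ?units"
    using B(1) by blast
  then have "finite B" "card B \<le> card ?units"
    using fun_space.independent_span_bound[OF _ B(2)] A by blast+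
  then have "finite D" "card D \<le> card A"
    using D(2,3) card_image_le[OF A, of "\<lambda>b a. of_bool (a = b) :: 'k"]
    by (simp_all add: finite_image_iff card_image)
  moreover have "(\<Sum>a\<in>A. c a * v s a) = 0"
    if vanish: "\<forall>t\<in>D. (\<Sum>a\<in>A. c a * v t a) = 0" and "s \<in> S" for c s
  proof -
    have row: "(\<Sum>a\<in>A. c a * row t a) = (\<Sum>a\<in>A. c a * v t a)" for t
      by (simp add: row_def)
    have "row s \<in> fun_space.span B"
      using B(3) \<open>s \<in> S\<close> by blast
    then have "(\<Sum>a\<in>A. c a * row s a) = 0"
      by (rule sum_mult_eq_0_on_span) (use vanish in \<open>auto simp: D(3) row\<close>)
    then show ?thesis
      by (simp add: row)
  qed
  ultimately show ?thesis
    using D(1) by (intro that) (auto simp: determining_set_def)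
qed

lemma exists_determining_set_ball_sum_kernel:
  fixes z :: "'a::field_char_0"
  assumes z: "primitive_root_unity m z" and S: "S \<subseteq> torus m n"
  obtains D where "determining_set (ball_sum_kernel m n :: (_ \<Rightarrow> 'a) set) S D"
    "card D \<le> card {a \<in> torus m n. ball_eigenvalue z n a = 0}"
proof -
  let ?A = "{a \<in> torus m n. ball_eigenvalue z n a = 0}"
  let ?V = "range (\<lambda>c x. \<Sum>a\<in>?A. c a * character (inverse z) n a x)"
  have "finite ?A"
    by simp
  then obtain D where D: "determining_set ?V S D" and "finite D" and card: "card D \<le> card ?A"
    by (rule exists_determining_set_card_le)
  have "g x = 0" if g: "g \<in> ball_sum_kernel m n" and g_D: "\<forall>y\<in>D. g y = 0" and x: "x \<in> S"
    for g :: "_ \<Rightarrow> 'a" and x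
  proof -
    let ?h = "\<lambda>y. \<Sum>a\<in>?A. fourier z m n g a * character (inverse z) n a y"
    have expansion: "?h y = of_nat m ^ n * g y" if "y \<in> S" for y
      using fourier_expansion_of_ball_sum_kernel[OF z subsetD[OF S that] g] ..
    have "?h y = 0" if "y \<in> D" for y
      unfolding expansion[OF subsetD[OF determining_set_subset[OF D] that]] using g_D that by simp
    then have "?h x = 0"
      by (rule determining_setD[OF D rangeI _ x])
    then show ?thesis
      unfolding expansion[OF x] using primitive_root_unity_pos[OF z] by simp
  qed
  then have "determining_set (ball_sum_kernel m n :: (_ \<Rightarrow> 'a) set) S D"
    using determining_set_subset[OF D] by (simp add: determining_set_def)
  then show ?thesis
    using card by (rule that)
qed

lemma indicator_diff_in_ball_sum_kernel:
  assumes "perfect_code m n S" "perfect_code m n T"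
  shows "(\<lambda>x. indicator S x - indicator T x :: 'a::ring_1) \<in> ball_sum_kernel m n"
proof -
  have "ball_sum m n (indicator U) x = (of_nat (ball_sum m n (indicator U) x) :: 'a)" for U x
    by (simp add: ball_sum_def indicator_def)
  then have "ball_sum m n (indicator U) x = (1 :: 'a)"
    if "perfect_code m n U" "x \<in> torus m n" for U x
    using that by (simp add: perfect_code_def)
  moreover have "ball_sum m n (\<lambda>y. indicator S y - indicator T y) x =
      ball_sum m n (indicator S) x - (ball_sum m n (indicator T) x :: 'a)" for x
    by (simp add: ball_sum_def sum.distrib sum_subtractf)
  ultimately show ?thesis
    using assms by (simp add: ball_sum_kernel_def)
qed

lemma determining_set_imp_perfect_code_subset:
  assumes D: "determining_set (ball_sum_kernel m n :: (_ \<Rightarrow> 'a::ring_1) set) S D"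
    and "perfect_code m n S" "perfect_code m n T" "D \<subseteq> T"
  shows "S \<subseteq> T"
proof -
  let ?g = "\<lambda>x. indicator S x - indicator T x :: 'a"
  have "?g \<in> ball_sum_kernel m n"
    using assms(2,3) by (rule indicator_diff_in_ball_sum_kernel)
  moreover have "?g x = 0" if "x \<in> D" for x
    using determining_set_subset[OF D] \<open>D \<subseteq> T\<close> that by (auto simp: indicator_def)
  ultimately have "?g x = 0" if "x \<in> S" for x
    using that by (rule determining_setD[OF D])
  then show ?thesis
    by (auto simp: indicator_def split: if_splits)
qed

theorem theorem2:
  fixes n :: nat and F :: "(nat \<Rightarrow> nat) set set"
  assumes "n \<ge> 1"
    and "prime (2 * n + 1)"
    and "F = {S. min_dominating_set (cartesian_power (cycle_graph (2 * n + 1)) n) S}"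
  shows "\<forall>S\<in>F. \<exists>D. defining_set F S D \<and> card D \<le> fact n * 2 ^ n"
proof
  fix S assume S: "S \<in> F"
  have code: "perfect_code (2 * n + 1) n T" if "T \<in> F" for T
    using that unfolding assms(3) by (intro min_dominating_set_imp_perfect_code) simp
  then have torus: "T \<subseteq> torus (2 * n + 1) n" if "T \<in> F" for T
    using that by (simp add: perfect_code_def)
  obtain z :: complex where z: "primitive_root_unity (2 * n + 1) z"
    using primitive_root_unity_cis[of "2 * n + 1"] by auto
  obtain D where D: "determining_set (ball_sum_kernel (2 * n + 1) n :: (_ \<Rightarrow> complex) set) S D"
    and card_D: "card D \<le> card {a \<in> torus (2 * n + 1) n. ball_eigenvalue z n a = 0}"
    using exists_determining_set_ball_sum_kernel[OF z torus[OF S]] .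
  have "T = S" if T: "T \<in> F" "D \<subseteq> T" for T
  proof -
    have "S \<subseteq> T"
      using determining_set_imp_perfect_code_subset[OF D code[OF S] code[OF T(1)] T(2)] .
    moreover have "card T \<le> card S"
      using S T(1) by (simp add: assms(3) min_dominating_set_def)
    ultimately show "T = S"
      using card_seteq finite_subset[OF torus[OF T(1)] finite_torus] by blast
  qed
  then have "defining_set F S D"
    using S determining_set_subset[OF D] unfolding defining_set_def by blast
  moreover have "card D \<le> fact n * 2 ^ n"
    using card_D card_zeros_ball_eigenvalue_le[OF assms(2) z] by (rule order_trans)
  ultimately show "\<exists>D. defining_set F S D \<and> card D \<le> fact n * 2 ^ n"
    by blast
qed

end
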